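(* Let $G$ be a finite supersolvable group. Then $G$ is an $LC$-nilpotent group.
   Context: $o(x)$ denotes the order of $x$. For a finite group $G$, $LCM(G)$ is the set of all $x\in G$ such that $o(x^n y)$ divides $\mathrm{lcm}(o(x^n),o(y))$ for all $y\in G$ and all integers $n$; $LC(G)$ is the subgroup generated by $LCM(G)$ (a characteristic subgroup). Put $LC_0(G)=1$, $LC_1(G)=LC(G)$, and for $i\ge 2$ define $LC_i(G)$ by $LC_i(G)/LC_{i-1}(G)=LC(G/LC_{i-1}(G))$. $G$ is $LC$-nilpotent if there is $k$ with $LC_k(G)=G$ and $LC_i(G)/LC_{i-1}(G)$ nilpotent for all $i=1,\dots,k$. *)

theory Defs
  imports "HOL-Algebra.Algebra"
begin

text \<open>\<open>LCM_set G\<close> is the set usually written \<open>LCM(G)\<close>; the bare name is reserved syntax in HOL.\<close>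

definition LCM_set :: "('a, 'b) monoid_scheme \<Rightarrow> 'a set" where
  "LCM_set G = {x \<in> carrier G. \<forall>y \<in> carrier G. \<forall>n::int.
     group.ord G (x [^]\<^bsub>G\<^esub> n \<otimes>\<^bsub>G\<^esub> y) dvd lcm (group.ord G (x [^]\<^bsub>G\<^esub> n)) (group.ord G y)}"

definition LC :: "('a, 'b) monoid_scheme \<Rightarrow> 'a set" where
  "LC G = generate G (LCM_set G)"

text \<open>The third equation is the full preimage of \<open>LC (G Mod N)\<close> under the projection
  \<open>G \<rightarrow> G Mod N\<close>, where \<open>N = LC_series G (Suc i)\<close>; see \<open>LC_series_quotient\<close> below.\<close>

fun LC_series :: "('a, 'b) monoid_scheme \<Rightarrow> nat \<Rightarrow> 'a set" where
  "LC_series G 0 = {\<one>\<^bsub>G\<^esub>}"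
| "LC_series G (Suc 0) = LC G"
| "LC_series G (Suc (Suc i)) =
     {x \<in> carrier G. LC_series G (Suc i) #>\<^bsub>G\<^esub> x \<in> LC (G Mod LC_series G (Suc i))}"

definition group_center :: "('a, 'b) monoid_scheme \<Rightarrow> 'a set" where
  "group_center G = {z \<in> carrier G. \<forall>x \<in> carrier G. z \<otimes>\<^bsub>G\<^esub> x = x \<otimes>\<^bsub>G\<^esub> z}"

definition normal_series :: "('a, 'b) monoid_scheme \<Rightarrow> nat \<Rightarrow> (nat \<Rightarrow> 'a set) \<Rightarrow> bool" where
  "normal_series G n H \<longleftrightarrow> H 0 = {\<one>\<^bsub>G\<^esub>} \<and> H n = carrier G \<and>
     (\<forall>i\<le>n. H i \<lhd> G) \<and> (\<forall>i<n. H i \<subseteq> H (Suc i))"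

definition nilpotent_group :: "('a, 'b) monoid_scheme \<Rightarrow> bool" where
  "nilpotent_group G \<longleftrightarrow> (\<exists>n H. normal_series G n H \<and>
     (\<forall>i<n. carrier (G\<lparr>carrier := H (Suc i)\<rparr> Mod H i) \<subseteq> group_center (G Mod H i)))"

definition supersolvable_group :: "('a, 'b) monoid_scheme \<Rightarrow> bool" where
  "supersolvable_group G \<longleftrightarrow> (\<exists>n H. normal_series G n H \<and>
     (\<forall>i<n. cyclic_group (G\<lparr>carrier := H (Suc i)\<rparr> Mod H i)))"

definition LC_nilpotent :: "('a, 'b) monoid_scheme \<Rightarrow> bool" where
  "LC_nilpotent G \<longleftrightarrow> (\<exists>k. LC_series G k = carrier G \<and>
     (\<forall>i\<in>{1..k}. nilpotent_group (G\<lparr>carrier := LC_series G i\<rparr> Mod LC_series G (i - 1))))"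

text \<open>The remaining facts justify the quotients above: each term of the series is normal in
  \<open>G\<close>, and consecutive quotients are as prescribed.\<close>

lemma (in group) ord_conj:
  assumes "g \<in> carrier G" "x \<in> carrier G"
  shows "ord (g \<otimes> x \<otimes> inv g) = ord x"
proof -
  have p: "(g \<otimes> x \<otimes> inv g) [^] n = g \<otimes> x [^] n \<otimes> inv g" for n :: nat
  proof (induction n)
    case 0 then show ?case using assms by simp
  next
    case (Suc n)
    have "inv g \<otimes> (g \<otimes> (x \<otimes> inv g)) = x \<otimes> inv g"
      using assms by (simp flip: m_assoc)
    with Suc assms show ?case by (simp add: m_assoc)
  qed
  have "g \<otimes> x [^] n \<otimes> inv g = \<one> \<longleftrightarrow> x [^] n = \<one>" for n :: nat
    using assms by (metis inv_closed inv_inv inv_solve_right' l_cancel_one' l_inv nat_pow_closed r_one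
        inv_equality l_one m_closed r_inv right_cancel)
  with p show ?thesis using assms by (simp add: ord_unique pow_eq_id)
qed

lemma (in group) int_pow_conj:
  assumes "g \<in> carrier G" "x \<in> carrier G"
  shows "(g \<otimes> x \<otimes> inv g) [^] (n::int) = g \<otimes> x [^] n \<otimes> inv g"
proof -
  have "group_hom G G (\<lambda>x. g \<otimes> x \<otimes> inv g)"
  proof (unfold_locales, rule homI)
    fix x y assume "x \<in> carrier G" "y \<in> carrier G"
    moreover from this have "inv g \<otimes> (g \<otimes> (y \<otimes> inv g)) = y \<otimes> inv g"
      using assms by (simp flip: m_assoc)
    ultimately show "g \<otimes> (x \<otimes> y) \<otimes> inv g = g \<otimes> x \<otimes> inv g \<otimes> (g \<otimes> y \<otimes> inv g)"
      using assms by (simp add: m_assoc)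
  qed (use assms in simp)
  from group_hom.hom_int_pow[OF this assms(2)] show ?thesis by simp
qed

lemma (in group) LCM_set_conj:
  assumes g: "g \<in> carrier G" and x: "x \<in> LCM_set G"
  shows "g \<otimes> x \<otimes> inv g \<in> LCM_set G"
proof -
  have xc: "x \<in> carrier G" using x by (simp add: LCM_set_def)
  have "ord ((g \<otimes> x \<otimes> inv g) [^] n \<otimes> y) dvd lcm (ord ((g \<otimes> x \<otimes> inv g) [^] n)) (ord y)"
    if y: "y \<in> carrier G" for y and n :: int
  proof -
    define z where "z = inv g \<otimes> y \<otimes> g"
    have z: "z \<in> carrier G" using g y by (simp add: z_def)
    have yz: "y = g \<otimes> z \<otimes> inv g"
      using g y by (simp add: z_def m_assoc) (simp flip: m_assoc)
    have "inv g \<otimes> (g \<otimes> (z \<otimes> inv g)) = z \<otimes> inv g"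
      using g z by (simp flip: m_assoc)
    then have "(g \<otimes> x \<otimes> inv g) [^] n \<otimes> y = g \<otimes> (x [^] n \<otimes> z) \<otimes> inv g"
      unfolding int_pow_conj[OF g xc] using g xc z by (simp add: yz m_assoc)
    moreover have "ord y = ord z" using g z by (simp add: yz ord_conj)
    ultimately show ?thesis
      using x g xc z by (simp add: int_pow_conj ord_conj LCM_set_def)
  qed
  then show ?thesis using g xc by (simp add: LCM_set_def)
qed

lemma (in group) LC_normal: "LC G \<lhd> G"
  unfolding LC_def
proof (rule normal_generateI)
  show "LCM_set G \<subseteq> carrier G" by (auto simp: LCM_set_def)
qed (rule LCM_set_conj)

lemma (in normal) preimage_normal:
  assumes K: "K \<lhd> G Mod H"
  shows "{x \<in> carrier G. H #> x \<in> K} \<lhd> G"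
    and "H \<subseteq> {x \<in> carrier G. H #> x \<in> K}"
    and "carrier (G\<lparr>carrier := {x \<in> carrier G. H #> x \<in> K}\<rparr> Mod H) = K"
proof -
  let ?P = "{x \<in> carrier G. H #> x \<in> K}"
  interpret Q: group "G Mod H" by (rule factorgroup_is_group)
  interpret K: normal K "G Mod H" by (rule K)
  interpret h: group_hom G "G Mod H" "\<lambda>x. H #> x"
    by unfold_locales (rule r_coset_hom_Mod)
  have sub: "subgroup ?P G"
  proof (rule subgroupI)
    show "?P \<noteq> {}" using K.one_closed h.hom_one by fastforce
  next
    fix a assume "a \<in> ?P"
    then show "inv a \<in> ?P" using K.m_inv_closed h.hom_inv by fastforce
  next
    fix a b assume "a \<in> ?P" "b \<in> ?P"
    then show "a \<otimes> b \<in> ?P" using K.m_closed h.hom_mult by fastforce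
  qed auto
  show "?P \<lhd> G"
  proof (rule normal_invI[OF sub])
    fix g x assume g: "g \<in> carrier G" and x: "x \<in> ?P"
    have "(H #> g) \<otimes>\<^bsub>G Mod H\<^esub> (H #> x) \<otimes>\<^bsub>G Mod H\<^esub> inv\<^bsub>G Mod H\<^esub> (H #> g) \<in> K"
      using x g by (intro K.inv_op_closed2) auto
    then show "g \<otimes> x \<otimes> inv g \<in> ?P" using g x
      by (simp del: mult_FactGroup flip: h.hom_inv h.hom_mult)
  qed
  show "H \<subseteq> ?P"
  proof
    fix x assume x: "x \<in> H"
    then have "H #> x = H" by (simp add: subgroup.rcos_const subgroup_axioms)
    then show "x \<in> ?P" using x K.one_closed subset by auto
  qed
  show "carrier (G\<lparr>carrier := ?P\<rparr> Mod H) = K"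
  proof -
    have "(#>\<^bsub>G\<lparr>carrier := ?P\<rparr>\<^esub>) H = (#>) H" by (simp add: r_coset_def fun_eq_iff)
    then have "carrier (G\<lparr>carrier := ?P\<rparr> Mod H) = (#>) H ` ?P" by (simp add: carrier_FactGroup)
    also have "\<dots> = K" using K.subset unfolding carrier_FactGroup by blast
    finally show ?thesis .
  qed
qed

lemma (in group) LC_series_normal: "LC_series G i \<lhd> G"
proof (induction i)
  case 0 then show ?case by (simp add: one_is_normal)
next
  case (Suc i)
  show ?case
  proof (cases i)
    case 0 then show ?thesis by (simp add: LC_normal)
  next
    case (Suc j)
    interpret N: normal "LC_series G (Suc j)" G using Suc.IH Suc by simp
    show ?thesis
      using N.preimage_normal(1)[OF group.LC_normal[OF N.factorgroup_is_group]] Suc by simp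
  qed
qed

lemma (in group) LC_series_quotient:
  assumes "i \<ge> 2"
  shows "LC_series G (i - 1) \<subseteq> LC_series G i"
    and "carrier (G\<lparr>carrier := LC_series G i\<rparr> Mod LC_series G (i - 1)) = LC (G Mod LC_series G (i - 1))"
proof -
  obtain j where i: "i = Suc (Suc j)" using assms by (metis add_2_eq_Suc le_Suc_ex)
  interpret N: normal "LC_series G (Suc j)" G by (rule LC_series_normal)
  have K: "LC (G Mod LC_series G (Suc j)) \<lhd> G Mod LC_series G (Suc j)"
    by (rule group.LC_normal[OF N.factorgroup_is_group])
  show "LC_series G (i - 1) \<subseteq> LC_series G i"
    using N.preimage_normal(2)[OF K] by (simp add: i)
  show "carrier (G\<lparr>carrier := LC_series G i\<rparr> Mod LC_series G (i - 1)) = LC (G Mod LC_series G (i - 1))"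
    using N.preimage_normal(3)[OF K] by (simp add: i)
qed

end

theory Submission
  imports Defs
begin

text \<open>
  The \<open>LC\<close>-series of a finite supersolvable group reaches the top because each of its steps is
  strict, and its factors are nilpotent because \<open>LC\<close> of a finite group always is.

  Nilpotency. For every finite group \<open>G\<close> the subgroup \<open>LC G\<close> is nilpotent. Suitable powers of
  an element of \<open>LCM_set G\<close> have prime power order, lie again in \<open>LCM_set G\<close> and generate the
  element. So \<open>LC G\<close> is generated by the subgroups \<open>LC_p G p\<close>, where \<open>LC_p G p\<close> is
  generated by the elements of \<open>LCM_set G\<close> of \<open>p\<close>-power order. The divisibility that defines
  \<open>LCM_set G\<close> keeps \<open>p\<close>-power order under multiplication by such elements, so \<open>LC_p G p\<close>
  is a normal \<open>p\<close>-group, and for distinct primes these groups meet trivially and therefore commute.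
  Nilpotency is then read off from centres: if \<open>M\<close> is a proper normal subgroup of \<open>LC G\<close>, some
  \<open>LC_p G p\<close> is not inside \<open>M\<close>; its image modulo \<open>M\<close> is a nontrivial \<open>p\<close>-group, with a
  nontrivial centre by the class equation, and that centre is central in all of \<open>LC G\<close> modulo
  \<open>M\<close>, since the other primes commute with it anyway. Hence the upper central series climbs to
  the top.

  Strictness. If \<open>N\<close> is a proper normal subgroup of a supersolvable group \<open>G\<close>, the first term of
  a normal series with cyclic factors that is not inside \<open>N\<close> has a nontrivial cyclic normal
  image in \<open>G Mod N\<close>, and with it comes a normal subgroup of prime order \<open>p\<close>. A generator \<open>x\<close>
  of it belongs to \<open>LCM_set (G Mod N)\<close>: an element \<open>y\<close> of order \<open>m\<close> acts on it as
  \<open>w \<mapsto> w\<^sup>k\<close> with \<open>k\<^sup>m \<equiv> 1\<close> modulo \<open>p\<close>, and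
  \<open>(w y)\<^sup>m\<close> is \<open>w\<close> to the power \<open>1 + k + \<dots> + k\<^bsup>m-1\<^esup>\<close>. Either
  \<open>k \<equiv> 1\<close> and \<open>w\<close>, \<open>y\<close> commute, or the geometric sum vanishes modulo \<open>p\<close> and
  the order of \<open>w y\<close> divides \<open>m\<close>.

  The crucial lemmas are \<open>LC_quotients_have_centre\<close>, \<open>prime_order_normalized_in_LCM_set\<close> and
  \<open>supersolvable_normal_cyclic_mod\<close>.
\<close>

(* The name then means primality of numbers, as in the definition of a p-group. *)
hide_const (open) Divisibility.prime

section \<open>Cosets and increasing chains\<close>

lemma (in normal) rcos_eq_one_iff:
  assumes "x \<in> carrier G"
  shows "H #> x = H \<longleftrightarrow> x \<in> H"
  using assms by (metis coset_join1 coset_join2 subgroup_axioms)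

lemma (in normal) quotient_hom: "group_hom G (G Mod H) (\<lambda>x. H #> x)"
  by (intro group_hom.intro group_hom_axioms.intro is_group factorgroup_is_group r_coset_hom_Mod)

lemma (in group) ord_pos:
  assumes "finite (carrier G)" "x \<in> carrier G"
  shows "ord x > 0"
  using ord_ge_1[OF assms] by simp

lemma increasing_chain_reaches_top:
  assumes fin: "finite A"
    and sub: "\<And>i. S i \<subseteq> A"
    and step: "\<And>i::nat. S i \<noteq> A \<Longrightarrow> S i \<subset> S (Suc i)"
  shows "\<exists>k. S k = A"
proof (rule ccontr)
  assume "\<nexists>k. S k = A"
  then have "S i \<subset> S (Suc i)" for i using step by blast
  then have lt: "card (S i) < card (S (Suc i))" for i
    using fin sub by (meson finite_subset psubset_card_mono)
  have "i \<le> card (S i)" for i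
  proof (induction i)
    case (Suc i) then show ?case using lt[of i] by linarith
  qed simp
  moreover have "card (S i) \<le> card A" for i using fin sub by (simp add: card_mono)
  ultimately show False by (meson not_less_eq_eq le_trans)
qed

section \<open>Elements of prime power order\<close>

text \<open>
  Divisibility of a power of \<open>p\<close> stands in for ``the order is a power of \<open>p\<close>'', which is the
  same for prime \<open>p\<close>; this form passes directly along divisibilities of orders.
\<close>

definition p_elements :: "('a, 'b) monoid_scheme \<Rightarrow> nat \<Rightarrow> 'a set" where
  "p_elements G p = {x \<in> carrier G. \<exists>k. group.ord G x dvd p ^ k}"

lemma (in group) p_elements_distinct_primes:
  assumes "prime p" "prime q" "p \<noteq> q" "x \<in> p_elements G p" "x \<in> p_elements G q"
  shows "x = \<one>"
proof -
  obtain k l where "ord x dvd p ^ k" "ord x dvd q ^ l" and x: "x \<in> carrier G"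
    using assms by (auto simp: p_elements_def)
  moreover have "coprime (p ^ k) (q ^ l)" using assms by (simp add: primes_coprime)
  ultimately have "ord x = 1" by (metis coprime_common_divisor_nat)
  then show ?thesis using ord_eq_1 x by simp
qed

text \<open>
  The primary decomposition of a single element, in the form of a test for membership in a
  subgroup. If the order of \<open>x\<close> is \<open>p\<^sup>a m\<close> with coprime factors, then by
  Bezout's identity \<open>x\<close> is a product of powers of \<open>x\<^sup>m\<close>, whose order is a power of \<open>p\<close>,
  and of \<open>x\<close> to the \<open>p\<^sup>a\<close>, whose order is smaller.
\<close>

lemma (in group) subgroup_contains_if_primary_powers:
  assumes S: "subgroup S G" and "x \<in> carrier G" "ord x > 0"
    and "\<And>n::nat. \<And>p. prime p \<Longrightarrow> x [^] n \<in> p_elements G p \<Longrightarrow> x [^] n \<in> S"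
  shows "x \<in> S"
  using assms(2-)
proof (induction "ord x" arbitrary: x rule: less_induct)
  case less
  note x = less.prems(1)
  show ?case
  proof (cases "ord x = 1")
    case True
    then show ?thesis using x S ord_eq_1 subgroup.one_closed by metis
  next
    case False
    then obtain p where p: "prime p" "p dvd ord x" using prime_factor_nat by blast
    define a where "a = multiplicity p (ord x)"
    define m where "m = ord x div p ^ a"
    have pa: "p ^ a dvd ord x" unfolding a_def by (rule multiplicity_dvd)
    have om: "ord x = p ^ a * m" using pa by (simp add: m_def)
    have npm: "\<not> p dvd m"
      unfolding m_def a_def using less.prems(2) p(1)
      by (intro multiplicity_decompose) (auto simp: not_prime_unit)
    have a0: "a > 0" using p less.prems(2) npm om by (cases a) auto
    have cop: "coprime m (p ^ a)" using prime_imp_coprime[OF p(1) npm] by (simp add: coprime_commute)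
    have m0: "m > 0" using om less.prems(2) by (cases m) auto
    have 1: "x [^] m \<in> S"
    proof (rule less.prems(3)[OF p(1)])
      have "ord (x [^] m) = p ^ a" using ord_pow[OF x, of m] om m0 by simp
      then show "x [^] m \<in> p_elements G p" using x by (auto simp: p_elements_def intro!: exI[of _ a])
    qed
    have 2: "x [^] (p ^ a) \<in> S"
    proof (rule less.hyps)
      have o: "ord (x [^] (p ^ a)) = m" using ord_pow[OF x pa] om p(1) by simp
      have "p ^ a > 1" using one_less_power[OF prime_gt_1_nat[OF p(1)] a0] .
      then show "ord (x [^] (p ^ a)) < ord x" using o om m0 by simp
      show "ord (x [^] (p ^ a)) > 0" using o m0 by simp
      fix n q assume "prime q" "(x [^] p ^ a) [^] (n::nat) \<in> p_elements G q"
      then show "(x [^] p ^ a) [^] n \<in> S"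
        using less.prems(3)[of q "p ^ a * n"] x by (simp add: nat_pow_pow)
    qed (use x in simp)
    obtain u v where uv: "u * int m + v * int (p ^ a) = 1"
      using bezout_int[of "int m" "int (p ^ a)"] cop by (auto simp del: of_nat_power)
    have "x = x [^] (u * int m + v * int (p ^ a))" using uv x by (simp add: int_pow_1)
    also have "\<dots> = (x [^] m) [^] u \<otimes> (x [^] (p ^ a)) [^] v"
      using x by (simp only: int_pow_mult int_pow_pow mult.commute[of u] mult.commute[of v]
          flip: int_pow_int)
    also have "\<dots> \<in> S"
      using 1 2 S by (simp add: subgroup.m_closed subgroup_int_pow_closed)
    finally show ?thesis .
  qed
qed

section \<open>Nontrivial centres of p-groups\<close>

text \<open>
  Sylow's existence theorem, applied to the first power of \<open>q\<close> instead of the highest one, gives a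
  subgroup of order exactly \<open>q\<close>.
\<close>

lemma (in group) cauchy_prime_order:
  assumes "finite (carrier G)" "prime q" "q dvd order G"
  obtains x where "x \<in> carrier G" "ord x = q"
proof -
  obtain m where "order G = q ^ 1 * m" using assms(3) by auto
  from sylow_thm[OF assms(2) is_group this assms(1)]
  obtain H where H: "subgroup H G" and cH: "card H = q" by auto
  interpret H: group "G\<lparr>carrier := H\<rparr>" using H by (rule subgroup_imp_group)
  have "H \<noteq> {\<one>}" using cH assms(2) by auto
  then obtain x where x: "x \<in> H" "x \<noteq> \<one>" using H subgroup.one_closed by blast
  then have xc: "x \<in> carrier G" using H subgroup.mem_carrier by metis
  have "x [^] q = \<one>"
    using H.pow_order_eq_1[of x] x cH by (simp add: order_def flip: nat_pow_consistent)
  then have "ord x dvd q" using xc pow_eq_id by simp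
  moreover have "ord x \<noteq> 1" using x xc ord_eq_1 by simp
  ultimately have "ord x = q" using assms(2) by (metis prime_nat_iff)
  with xc that show thesis by blast
qed

text \<open>
  The class equation: conjugacy classes have sizes dividing the group order, so those with more
  than one element have size divisible by \<open>p\<close>. If the centre were trivial, the class of the identity
  would be the only singleton class, and the order would be 1 modulo \<open>p\<close>.
\<close>

lemma (in group) p_group_centre_nontrivial:
  assumes fin: "finite (carrier G)" and p: "prime p"
    and pel: "carrier G \<subseteq> p_elements G p" and nt: "carrier G \<noteq> {\<one>}"
  shows "\<exists>z\<in>group_center G. z \<noteq> \<one>"
proof -
  define \<phi> where "\<phi> = (\<lambda>g. \<lambda>h\<in>carrier G. g \<otimes> h \<otimes> inv g)"
  interpret A: group_action G "carrier G" \<phi>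
    unfolding \<phi>_def by (rule action_by_conjugation)
  have only_p: "q = p" if q: "prime q" "q dvd order G" for q
  proof -
    obtain x where x: "x \<in> carrier G" "ord x = q" using cauchy_prime_order[OF fin q] .
    then obtain k where "q dvd p ^ k" using pel by (auto simp: p_elements_def)
    then show ?thesis using q p by (metis prime_dvd_power primes_dvd_imp_eq)
  qed
  (* All prime factors of a divisor of the group order are p. *)
  have p_dvd: "p dvd n" if "n dvd order G" "n \<noteq> 1" for n
    using that only_p by (metis dvd_trans prime_factor_nat)
  have "order G \<noteq> 1"
  proof
    assume "order G = 1"
    then obtain a where "carrier G = {a}" by (auto simp: order_def card_1_singleton_iff)
    then show False using nt one_closed by auto
  qed
  then have p_order: "p dvd order G" by (rule p_dvd[OF dvd_refl])
  have orbit: "orbit G \<phi> x = {g \<otimes> x \<otimes> inv g | g. g \<in> carrier G}" if "x \<in> carrier G" for x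
    using that by (auto simp: orbit_def \<phi>_def)
  have fixed: "x \<in> group_center G" if x: "x \<in> carrier G" and c: "card (orbit G \<phi> x) = 1" for x
  proof -
    obtain w where w: "orbit G \<phi> x = {w}" using c by (auto simp: card_1_singleton_iff)
    have "x \<in> orbit G \<phi> x" using A.orbit_refl[OF x] .
    then have "orbit G \<phi> x = {x}" using w by simp
    then have "g \<otimes> x \<otimes> inv g = x" if "g \<in> carrier G" for g
      using that orbit[OF x] by blast
    then have "x \<otimes> g = g \<otimes> x" if "g \<in> carrier G" for g
      using that x by (metis inv_solve_right' m_closed)
    then show ?thesis using x by (simp add: group_center_def)
  qed
  show ?thesis
  proof (rule ccontr)
    assume "\<not> ?thesis"
    then have triv: "x = \<one>" if "x \<in> group_center G" for x using that by blast
    have o1: "orbit G \<phi> \<one> = {\<one>}" unfolding orbit[OF one_closed] by (auto intro!: exI[of _ \<one>])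
    define Os where "Os = orbits G (carrier G) \<phi>"
    have part: "partition (carrier G) Os" unfolding Os_def by (rule A.orbit_partition)
    have finOs: "finite Os" using fin by (simp add: Os_def orbits_def setcompr_eq_image)
    have UOs: "\<Union>Os = carrier G" using part unfolding partition_def by blast
    have disj: "A \<inter> B = {}" if "A \<in> Os" "B \<in> Os" "A \<noteq> B" for A B
      using part that unfolding partition_def by blast
    have "order G = (\<Sum>C\<in>Os. card C)"
      unfolding order_def UOs[symmetric]
      by (rule card_Union_disjoint)
        (use disj fin UOs in \<open>auto simp: pairwise_def disjnt_def intro: finite_subset\<close>)
    also have "\<dots> = card {\<one>} + (\<Sum>C\<in>Os - {{\<one>}}. card C)"
      using finOs o1 by (intro sum.remove) (auto simp: Os_def orbits_def)
    finally have "order G = 1 + (\<Sum>C\<in>Os - {{\<one>}}. card C)" by simp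
    moreover have "p dvd (\<Sum>C\<in>Os - {{\<one>}}. card C)"
    proof (rule dvd_sum)
      fix C assume C: "C \<in> Os - {{\<one>}}"
      then obtain x where x: "x \<in> carrier G" "C = orbit G \<phi> x" by (auto simp: Os_def orbits_def)
      have "card C dvd order G"
        using A.orbit_stabilizer_theorem[OF x(1)] x(2) by (metis dvd_triv_left)
      moreover have "card C \<noteq> 1" using fixed[OF x(1)] triv x C o1 by auto
      ultimately show "p dvd card C" by (rule p_dvd)
    qed
    ultimately have "p dvd 1" using p_order by (metis dvd_add_left_iff)
    then show False using p by simp
  qed
qed

section \<open>Nilpotency from centres of quotients\<close>

text \<open>
  The preimage in \<open>G\<close> of the centre of \<open>G Mod M\<close>. Commutators express it without cosets, so
  that it can be compared between a group and its subgroups and quotients.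
\<close>

definition central_mod :: "('a, 'b) monoid_scheme \<Rightarrow> 'a set \<Rightarrow> 'a set" where
  "central_mod G M = {z \<in> carrier G. \<forall>g \<in> carrier G.
     z \<otimes>\<^bsub>G\<^esub> g \<otimes>\<^bsub>G\<^esub> inv\<^bsub>G\<^esub> z \<otimes>\<^bsub>G\<^esub> inv\<^bsub>G\<^esub> g \<in> M}"

text \<open>
  Every nontrivial quotient has a nontrivial centre. For finite groups this is a criterion for nilpotency
  that passes to quotients without any bookkeeping of series.
\<close>

definition quotients_have_centre :: "('a, 'b) monoid_scheme \<Rightarrow> bool" where
  "quotients_have_centre G \<longleftrightarrow>
     (\<forall>M. M \<lhd> G \<longrightarrow> M \<noteq> carrier G \<longrightarrow> \<not> central_mod G M \<subseteq> M)"

lemma (in group) commutator_eq_one_iff: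
  assumes "x \<in> carrier G" "y \<in> carrier G"
  shows "x \<otimes> y \<otimes> inv x \<otimes> inv y = \<one> \<longleftrightarrow> x \<otimes> y = y \<otimes> x"
proof -
  have "x \<otimes> y \<otimes> inv x \<otimes> inv y = (x \<otimes> y) \<otimes> inv (y \<otimes> x)"
    using assms by (simp add: inv_mult_group m_assoc)
  also have "\<dots> = \<one> \<longleftrightarrow> x \<otimes> y = \<one> \<otimes> (y \<otimes> x)"
    using assms by (intro inv_solve_right') simp_all
  also have "\<one> \<otimes> (y \<otimes> x) = y \<otimes> x" using assms by simp
  finally show ?thesis .
qed

lemma (in group) group_center_normal: "group_center G \<lhd> G"
proof (rule normal_invI)
  show "subgroup (group_center G) G"
  proof (rule subgroupI)
    show "group_center G \<noteq> {}" unfolding group_center_def using one_closed by fastforce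
  next
    fix a assume "a \<in> group_center G"
    then show "inv a \<in> group_center G"
      by (auto simp: group_center_def) (metis inv_closed inv_inv inv_mult_group)
  next
    fix a b assume ab: "a \<in> group_center G" "b \<in> group_center G"
    then have c: "a \<in> carrier G" "b \<in> carrier G" by (simp_all add: group_center_def)
    have "a \<otimes> b \<otimes> x = x \<otimes> (a \<otimes> b)" if x: "x \<in> carrier G" for x
    proof -
      have "a \<otimes> b \<otimes> x = a \<otimes> (b \<otimes> x)" using c x by (simp add: m_assoc)
      also have "b \<otimes> x = x \<otimes> b" using ab x unfolding group_center_def by blast
      also have "a \<otimes> (x \<otimes> b) = (a \<otimes> x) \<otimes> b" using c x by (simp add: m_assoc)
      also have "a \<otimes> x = x \<otimes> a" using ab x unfolding group_center_def by blast
      finally show ?thesis using c x by (simp add: m_assoc)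
    qed
    then show "a \<otimes> b \<in> group_center G" using c unfolding group_center_def by blast
  qed (auto simp: group_center_def)
next
  fix x h assume "x \<in> carrier G" "h \<in> group_center G"
  then have "h \<otimes> x = x \<otimes> h" unfolding group_center_def by blast
  from this[symmetric] have "x \<otimes> h \<otimes> inv x = h \<otimes> x \<otimes> inv x" by simp
  moreover have "h \<in> carrier G" using \<open>h \<in> group_center G\<close> by (simp add: group_center_def)
  ultimately have "x \<otimes> h \<otimes> inv x = h" using \<open>x \<in> carrier G\<close> by (simp add: m_assoc)
  then show "x \<otimes> h \<otimes> inv x \<in> group_center G" using \<open>h \<in> group_center G\<close> by simp
qed

lemma (in normal) central_mod_eq_preimage:
  "central_mod G H = {x \<in> carrier G. H #> x \<in> group_center (G Mod H)}"
proof -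
  interpret h: group_hom G "G Mod H" "\<lambda>x. H #> x" by (rule quotient_hom)
  have "H #> x \<in> group_center (G Mod H) \<longleftrightarrow> (\<forall>g\<in>carrier G. x \<otimes> g \<otimes> inv x \<otimes> inv g \<in> H)"
    if x: "x \<in> carrier G" for x
  proof -
    have "H #> x \<in> group_center (G Mod H) \<longleftrightarrow>
      (\<forall>g\<in>carrier G. (H #> x) \<otimes>\<^bsub>G Mod H\<^esub> (H #> g) = (H #> g) \<otimes>\<^bsub>G Mod H\<^esub> (H #> x))"
      using x by (auto simp: group_center_def carrier_FactGroup)
    also have "\<dots> \<longleftrightarrow> (\<forall>g\<in>carrier G. H #> (x \<otimes> g \<otimes> inv x \<otimes> inv g) = \<one>\<^bsub>G Mod H\<^esub>)"
    proof (intro ball_cong refl)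
      fix g assume "g \<in> carrier G"
      then show "(H #> x) \<otimes>\<^bsub>G Mod H\<^esub> (H #> g) = (H #> g) \<otimes>\<^bsub>G Mod H\<^esub> (H #> x) \<longleftrightarrow>
          H #> (x \<otimes> g \<otimes> inv x \<otimes> inv g) = \<one>\<^bsub>G Mod H\<^esub>"
        using h.H.commutator_eq_one_iff[of "H #> x" "H #> g"] x
        by (simp del: mult_FactGroup one_FactGroup)
    qed
    also have "\<dots> \<longleftrightarrow> (\<forall>g\<in>carrier G. x \<otimes> g \<otimes> inv x \<otimes> inv g \<in> H)"
      by (intro ball_cong refl, subst one_FactGroup, rule rcos_eq_one_iff) (use x in simp)
    finally show ?thesis .
  qed
  then show ?thesis by (auto simp: central_mod_def)
qed

lemma (in normal)
  shows central_mod_normal: "central_mod G H \<lhd> G"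
    and central_mod_increasing: "H \<subseteq> central_mod G H"
    and central_mod_quotient: "carrier (G\<lparr>carrier := central_mod G H\<rparr> Mod H) = group_center (G Mod H)"
  unfolding central_mod_eq_preimage
  by (rule preimage_normal[OF group.group_center_normal[OF factorgroup_is_group]])+

text \<open>
  The upper central series grows as long as it is proper, so in a finite group it ends at the
  whole group.
\<close>

lemma (in group) nilpotent_group_if_quotients_have_centre:
  assumes fin: "finite (carrier G)" and Q: "quotients_have_centre G"
  shows "nilpotent_group G"
proof -
  define Z where "Z = rec_nat {\<one>} (\<lambda>_. central_mod G)"
  have Z0: "Z 0 = {\<one>}" and ZS: "Z (Suc i) = central_mod G (Z i)" for i by (simp_all add: Z_def)
  have norm: "Z i \<lhd> G" for i
  proof (induction i)
    case (Suc i) then show ?case by (simp add: ZS normal.central_mod_normal)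
  qed (simp add: Z0 one_is_normal)
  have incr: "Z i \<subseteq> Z (Suc i)" for i
    using normal.central_mod_increasing[OF norm] by (simp add: ZS)
  have "\<exists>k. Z k = carrier G"
  proof (rule increasing_chain_reaches_top[OF fin])
    show "Z i \<subseteq> carrier G" for i using norm by (simp add: normal_imp_subgroup subgroup.subset)
    show "Z i \<noteq> carrier G \<Longrightarrow> Z i \<subset> Z (Suc i)" for i
      using Q norm[of i] incr[of i] unfolding quotients_have_centre_def ZS by blast
  qed
  then obtain k where "Z k = carrier G" ..
  then have "normal_series G k Z" using Z0 norm incr by (simp add: normal_series_def)
  moreover have "carrier (G\<lparr>carrier := Z (Suc i)\<rparr> Mod Z i) \<subseteq> group_center (G Mod Z i)" for i
    using normal.central_mod_quotient[OF norm] by (simp add: ZS)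
  ultimately show ?thesis unfolding nilpotent_group_def by blast
qed

text \<open>
  A quotient of \<open>G Mod H\<close> is a quotient of \<open>G\<close>, by the preimage of the normal subgroup.
\<close>

lemma (in normal) quotients_have_centre_quotient:
  assumes Q: "quotients_have_centre G"
  shows "quotients_have_centre (G Mod H)"
  unfolding quotients_have_centre_def
proof (intro allI impI)
  fix K assume K: "K \<lhd> G Mod H" and ne: "K \<noteq> carrier (G Mod H)"
  interpret h: group_hom G "G Mod H" "\<lambda>x. H #> x" by (rule quotient_hom)
  define M where "M = {x \<in> carrier G. H #> x \<in> K}"
  have M: "M \<lhd> G" unfolding M_def by (rule preimage_normal(1)[OF K])
  have "K \<subseteq> carrier (G Mod H)" using K normal_imp_subgroup subgroup.subset by blast
  then have "M \<noteq> carrier G" using ne by (auto simp: M_def carrier_FactGroup)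
  then obtain z where z: "z \<in> central_mod G M" "z \<notin> M"
    using Q M unfolding quotients_have_centre_def by blast
  then have zc: "z \<in> carrier G" by (simp add: central_mod_def)
  have "H #> z \<in> central_mod (G Mod H) K"
    unfolding central_mod_def
  proof (intro CollectI conjI ballI)
    show "H #> z \<in> carrier (G Mod H)" using zc by simp
    fix y assume "y \<in> carrier (G Mod H)"
    then obtain g where g: "g \<in> carrier G" "y = H #> g" by (auto simp: carrier_FactGroup)
    have "H #> (z \<otimes> g \<otimes> inv z \<otimes> inv g) \<in> K"
      using z(1) g(1) by (auto simp: central_mod_def M_def)
    then show "(H #> z) \<otimes>\<^bsub>G Mod H\<^esub> y \<otimes>\<^bsub>G Mod H\<^esub> inv\<^bsub>G Mod H\<^esub> (H #> z) \<otimes>\<^bsub>G Mod H\<^esub> inv\<^bsub>G Mod H\<^esub> y \<in> K"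
      using zc g by (simp del: mult_FactGroup)
  qed
  moreover have "H #> z \<notin> K" using z(2) zc by (simp add: M_def)
  ultimately show "\<not> central_mod (G Mod H) K \<subseteq> K" by blast
qed

text \<open>Quotients of finite \<open>p\<close>-groups are finite \<open>p\<close>-groups.\<close>

lemma (in group) p_group_quotients_have_centre:
  assumes fin: "finite (carrier G)" and p: "prime p" and pel: "carrier G \<subseteq> p_elements G p"
  shows "quotients_have_centre G"
  unfolding quotients_have_centre_def
proof (intro allI impI)
  fix M assume M: "M \<lhd> G" and ne: "M \<noteq> carrier G"
  interpret M: normal M G by (rule M)
  interpret h: group_hom G "G Mod M" "\<lambda>x. M #> x" by (rule M.quotient_hom)
  have "carrier (G Mod M) \<subseteq> p_elements (G Mod M) p"
  proof
    fix y assume "y \<in> carrier (G Mod M)"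
    then obtain x where x: "x \<in> carrier G" "y = M #> x" by (auto simp: carrier_FactGroup)
    then obtain k where "ord x dvd p ^ k" using pel by (auto simp: p_elements_def)
    then have "x [^] (p ^ k) = \<one>" using x pow_eq_id by simp
    then have "y [^]\<^bsub>G Mod M\<^esub> (p ^ k) = \<one>\<^bsub>G Mod M\<^esub>"
      using x h.hom_nat_pow[OF x(1), of "p ^ k"] h.hom_one by simp
    then have "h.H.ord y dvd p ^ k" using x h.H.pow_eq_id[of y] by simp
    then show "y \<in> p_elements (G Mod M) p" using x by (auto simp: p_elements_def)
  qed
  moreover have "carrier (G Mod M) \<noteq> {\<one>\<^bsub>G Mod M\<^esub>}"
    using ne M.subset M.rcos_eq_one_iff by (auto simp: carrier_FactGroup)
  moreover have "finite (carrier (G Mod M))" using fin by (simp add: carrier_FactGroup)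
  ultimately obtain w where w: "w \<in> group_center (G Mod M)" "w \<noteq> \<one>\<^bsub>G Mod M\<^esub>"
    using h.H.p_group_centre_nontrivial[OF _ p] by blast
  then obtain z where z: "z \<in> carrier G" "w = M #> z"
    by (auto simp: group_center_def carrier_FactGroup)
  then have "z \<in> central_mod G M" using w by (simp add: M.central_mod_eq_preimage)
  moreover have "z \<notin> M" using z w M.rcos_eq_one_iff by simp
  ultimately show "\<not> central_mod G M \<subseteq> M" by blast
qed

section \<open>Nilpotency of the subgroup generated by LCM elements\<close>

definition LC_p :: "('a, 'b) monoid_scheme \<Rightarrow> nat \<Rightarrow> 'a set" where
  "LC_p G p = generate G (LCM_set G \<inter> p_elements G p)"

lemma (in group) LCM_set_pow:
  assumes "x \<in> LCM_set G"
  shows "x [^] (n::int) \<in> LCM_set G"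
proof -
  have x: "x \<in> carrier G" using assms by (simp add: LCM_set_def)
  then show ?thesis using assms by (auto simp: LCM_set_def int_pow_pow)
qed

text \<open>
  The lcm of two powers of \<open>p\<close> is a power of \<open>p\<close>, so multiplying by one generator, or by its
  inverse, preserves \<open>p\<close>-power order. The factor \<open>y\<close> stays arbitrary because a
  product \<open>h1 h2\<close> of generators is absorbed one factor after the other: first \<open>h2 y\<close>, then
  \<open>h1 (h2 y)\<close>.
\<close>

lemma (in group) LC_p_mult_p_elements:
  assumes h: "h \<in> LC_p G p" and "y \<in> p_elements G p"
  shows "h \<otimes> y \<in> p_elements G p"
proof -
  let ?S = "LCM_set G \<inter> p_elements G p"
  have gen: "x [^] n \<otimes> y \<in> p_elements G p"
    if x: "x \<in> ?S" and y: "y \<in> p_elements G p" for x y and n :: int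
  proof -
    have c: "x \<in> carrier G" "y \<in> carrier G" using x y by (auto simp: p_elements_def)
    obtain k l where k: "ord x dvd p ^ k" and l: "ord y dvd p ^ l"
      using x y by (auto simp: p_elements_def)
    have "(x [^] n) [^] (p ^ k) = \<one>"
    proof -
      have "(x [^] n) [^] (p ^ k) = (x [^] (p ^ k)) [^] n"
        using c by (simp add: int_pow_pow mult.commute flip: int_pow_int)
      also have "x [^] (p ^ k) = \<one>" using k c pow_eq_id by simp
      finally show ?thesis by simp
    qed
    then have "ord (x [^] n) dvd p ^ k" using c pow_eq_id by simp
    then have bound: "lcm (ord (x [^] n)) (ord y) dvd p ^ (k + l)"
      using l by (simp add: power_add)
    have "ord (x [^] n \<otimes> y) dvd lcm (ord (x [^] n)) (ord y)"
      using x c by (auto simp: LCM_set_def)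
    from dvd_trans[OF this bound] show ?thesis using c by (auto simp: p_elements_def)
  qed
  have sub: "?S \<subseteq> carrier G" by (auto simp: LCM_set_def)
  show ?thesis using h assms(2) unfolding LC_p_def
  proof (induction arbitrary: y rule: generate.induct)
    case one
    then show ?case by (simp add: p_elements_def)
  next
    case (incl h)
    then show ?case using gen[of h y 1] sub by (auto simp: int_pow_1)
  next
    case (inv h)
    then show ?case using gen[of h y "-1"] sub by (auto simp: int_pow_neg int_pow_1)
  next
    case (eng h1 h2)
    have "h1 \<in> carrier G" "h2 \<in> carrier G" "y \<in> carrier G"
      using eng generate_in_carrier[OF sub] by (auto simp: p_elements_def)
    then show ?case using eng by (simp add: m_assoc)
  qed
qed

lemma (in group) LC_p_subset_p_elements: "LC_p G p \<subseteq> p_elements G p"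
proof
  fix h assume h: "h \<in> LC_p G p"
  have "h \<in> carrier G"
    using h unfolding LC_p_def by (rule generate_in_carrier[rotated]) (auto simp: LCM_set_def)
  moreover have "\<one> \<in> p_elements G p" by (simp add: p_elements_def)
  ultimately show "h \<in> p_elements G p" using LC_p_mult_p_elements[OF h, of \<one>] by simp
qed

lemma (in group) LC_p_normal: "LC_p G p \<lhd> G"
  unfolding LC_p_def
proof (rule normal_generateI)
  show "LCM_set G \<inter> p_elements G p \<subseteq> carrier G" by (auto simp: LCM_set_def)
  show "g \<otimes> h \<otimes> inv g \<in> LCM_set G \<inter> p_elements G p"
    if "h \<in> LCM_set G \<inter> p_elements G p" "g \<in> carrier G" for h g
    using that LCM_set_conj[of g h] by (auto simp: p_elements_def ord_conj)
qed

lemma (in group) LC_p_subset_LC: "LC_p G p \<subseteq> LC G"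
  unfolding LC_p_def LC_def by (rule mono_generate) simp

text \<open>
  Both subgroups are normal, so the commutator lies in both, and only the identity has an order that is a
  power of two distinct primes.
\<close>

lemma (in group) LC_p_commute:
  assumes "prime p" "prime q" "p \<noteq> q" "x \<in> LC_p G p" "y \<in> LC_p G q"
  shows "x \<otimes> y = y \<otimes> x"
proof -
  interpret P: normal "LC_p G p" G by (rule LC_p_normal)
  interpret Q: normal "LC_p G q" G by (rule LC_p_normal)
  have c: "x \<in> carrier G" "y \<in> carrier G" using assms(4,5) by auto
  have "x \<otimes> y \<otimes> inv x \<otimes> inv y = x \<otimes> (y \<otimes> inv x \<otimes> inv y)" using c by (simp add: m_assoc)
  also have "\<dots> \<in> LC_p G p" using assms(4) c by (intro P.m_closed P.inv_op_closed2) auto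
  finally have "x \<otimes> y \<otimes> inv x \<otimes> inv y \<in> LC_p G p" .
  moreover have "x \<otimes> y \<otimes> inv x \<otimes> inv y \<in> LC_p G q"
    using assms(5) c by (intro Q.m_closed Q.inv_op_closed2) auto
  ultimately have "x \<otimes> y \<otimes> inv x \<otimes> inv y = \<one>"
    using LC_p_subset_p_elements p_elements_distinct_primes[OF assms(1-3)] by blast
  then show ?thesis using c commutator_eq_one_iff by simp
qed

text \<open>\<open>LC G\<close> is generated by the subgroups \<open>LC_p G p\<close>, stated as a test for inclusion.\<close>

lemma (in group) LC_subset_if_LC_p_subset:
  assumes fin: "finite (carrier G)" and S: "subgroup S G"
    and p: "\<And>p. prime p \<Longrightarrow> LC_p G p \<subseteq> S"
  shows "LC G \<subseteq> S"
  unfolding LC_def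
proof (rule generate_subgroup_incl[OF _ S], rule subsetI)
  fix x assume x: "x \<in> LCM_set G"
  then have xc: "x \<in> carrier G" by (simp add: LCM_set_def)
  show "x \<in> S"
  proof (rule subgroup_contains_if_primary_powers[OF S xc ord_pos[OF fin xc]])
    fix n :: nat and p assume "prime p" "x [^] n \<in> p_elements G p"
    moreover have "x [^] n \<in> LCM_set G" using LCM_set_pow[OF x, of "int n"] by (simp add: int_pow_int)
    ultimately have "x [^] n \<in> LC_p G p" unfolding LC_p_def by (intro generate.incl) simp
    then show "x [^] n \<in> S" using p \<open>prime p\<close> by blast
  qed
qed

text \<open>
  This is the preimage of the centralizer of the coset of \<open>z\<close>. The closure computations use
  \<open>[z, a\<inverse>] = a\<inverse> [z, a]\<inverse> a\<close> and
  \<open>[z, a b] = [z, a] (a [z, b] a\<inverse>)\<close>.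
\<close>

lemma (in normal) commuting_mod_subgroup:
  assumes z: "z \<in> carrier G"
  shows "subgroup {g \<in> carrier G. z \<otimes> g \<otimes> inv z \<otimes> inv g \<in> H} G"
proof (rule subgroupI)
  show "{g \<in> carrier G. z \<otimes> g \<otimes> inv z \<otimes> inv g \<in> H} \<noteq> {}"
    using z by (intro ex_in_conv[THEN iffD1] exI[of _ \<one>]) simp
next
  fix a assume a: "a \<in> {g \<in> carrier G. z \<otimes> g \<otimes> inv z \<otimes> inv g \<in> H}"
  then have cancel: "inv a \<otimes> (a \<otimes> t) = t" if "t \<in> carrier G" for t
    using that by (simp flip: m_assoc)
  have "inv a \<otimes> inv (z \<otimes> a \<otimes> inv z \<otimes> inv a) \<otimes> a \<in> H"
    using a by (intro inv_op_closed1) auto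
  also have "inv a \<otimes> inv (z \<otimes> a \<otimes> inv z \<otimes> inv a) \<otimes> a = z \<otimes> inv a \<otimes> inv z \<otimes> inv (inv a)"
    using a z by (simp add: inv_mult_group m_assoc cancel)
  finally show "inv a \<in> {g \<in> carrier G. z \<otimes> g \<otimes> inv z \<otimes> inv g \<in> H}" using a by simp
next
  fix a b assume ab: "a \<in> {g \<in> carrier G. z \<otimes> g \<otimes> inv z \<otimes> inv g \<in> H}"
    "b \<in> {g \<in> carrier G. z \<otimes> g \<otimes> inv z \<otimes> inv g \<in> H}"
  then have cancel: "inv a \<otimes> (a \<otimes> t) = t" "inv z \<otimes> (z \<otimes> t) = t" if "t \<in> carrier G" for t
    using z that by (simp_all flip: m_assoc)
  have "(z \<otimes> a \<otimes> inv z \<otimes> inv a) \<otimes> (a \<otimes> (z \<otimes> b \<otimes> inv z \<otimes> inv b) \<otimes> inv a) \<in> H"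
    by (rule subgroup.m_closed[OF subgroup_axioms]) (use ab in \<open>auto intro: inv_op_closed2\<close>)
  also have "(z \<otimes> a \<otimes> inv z \<otimes> inv a) \<otimes> (a \<otimes> (z \<otimes> b \<otimes> inv z \<otimes> inv b) \<otimes> inv a)
      = z \<otimes> (a \<otimes> b) \<otimes> inv z \<otimes> inv (a \<otimes> b)"
    using ab z by (simp add: inv_mult_group m_assoc cancel)
  finally show "a \<otimes> b \<in> {g \<in> carrier G. z \<otimes> g \<otimes> inv z \<otimes> inv g \<in> H}" using ab by simp
qed auto

text \<open>
  An element that is central modulo \<open>M\<close> in some \<open>LC_p G p\<close> not inside \<open>M\<close> is central modulo \<open>M\<close> in
  \<open>LC G\<close>: the elements commuting with it modulo \<open>M\<close> form a subgroup, which contains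
  \<open>LC_p G p\<close> by choice and \<open>LC_p G q\<close> for \<open>q \<noteq> p\<close> by commutation.
\<close>

lemma (in group) LC_quotients_have_centre:
  assumes fin: "finite (carrier G)"
  shows "quotients_have_centre (G\<lparr>carrier := LC G\<rparr>)"
  unfolding quotients_have_centre_def
proof (intro allI impI)
  let ?L = "G\<lparr>carrier := LC G\<rparr>"
  fix M assume M: "M \<lhd> ?L" and "M \<noteq> carrier ?L"
  have L: "subgroup (LC G) G" using LC_normal by (rule normal_imp_subgroup)
  have Lc: "LC G \<subseteq> carrier G" using L by (rule subgroup.subset)
  interpret L: group ?L using L by (rule subgroup_imp_group)
  interpret M: normal M ?L by (rule M)
  have M_sub: "M \<subseteq> LC G" using M.subset by simp
  have MG: "subgroup M G" using incl_subgroup[OF L M.subgroup_axioms] .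
  have invL: "inv\<^bsub>?L\<^esub> x = inv x" if "x \<in> LC G" for x using L that by (rule m_inv_consistent)
  obtain p where p: "prime p" and np: "\<not> LC_p G p \<subseteq> M"
    using LC_subset_if_LC_p_subset[OF fin MG] \<open>M \<noteq> carrier ?L\<close> M_sub by auto
  let ?P = "G\<lparr>carrier := LC_p G p\<rparr>"
  have P: "subgroup (LC_p G p) G" using LC_p_normal by (rule normal_imp_subgroup)
  have PL: "subgroup (LC_p G p) ?L" using subgroup_incl[OF P L LC_p_subset_LC] .
  interpret P: group ?P using P by (rule subgroup_imp_group)
  have "M \<inter> LC_p G p \<lhd> ?P" using L.normal_Int_subgroup[OF PL M] by simp
  moreover have "M \<inter> LC_p G p \<noteq> LC_p G p" using np by blast
  moreover have "quotients_have_centre ?P"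
  proof (rule P.p_group_quotients_have_centre[OF _ p])
    show "finite (carrier ?P)" using fin subgroup.subset[OF P] by (simp add: finite_subset)
    show "carrier ?P \<subseteq> p_elements ?P p"
    proof
      fix x assume x: "x \<in> carrier ?P"
      then have "x \<in> p_elements G p" using LC_p_subset_p_elements by auto
      then obtain k where "x [^] (p ^ k) = \<one>" by (auto simp: p_elements_def pow_eq_id)
      then have "x [^]\<^bsub>?P\<^esub> (p ^ k) = \<one>\<^bsub>?P\<^esub>" by (simp flip: nat_pow_consistent)
      then show "x \<in> p_elements ?P p" using P.pow_eq_id[OF x] x by (auto simp: p_elements_def)
    qed
  qed
  ultimately obtain z where z: "z \<in> central_mod ?P (M \<inter> LC_p G p)" "z \<notin> M \<inter> LC_p G p"
    unfolding quotients_have_centre_def by fastforce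
  have zP: "z \<in> LC_p G p" using z(1) by (simp add: central_mod_def)
  then have zL: "z \<in> LC G" using LC_p_subset_LC by blast
  have zM: "z \<notin> M" using z(2) zP by blast
  define C where "C = {g \<in> carrier ?L. z \<otimes>\<^bsub>?L\<^esub> g \<otimes>\<^bsub>?L\<^esub> inv\<^bsub>?L\<^esub> z \<otimes>\<^bsub>?L\<^esub> inv\<^bsub>?L\<^esub> g \<in> M}"
  have "subgroup C ?L" unfolding C_def by (rule M.commuting_mod_subgroup) (use zL in simp)
  then have CG: "subgroup C G" by (rule incl_subgroup[OF L])
  have "LC_p G q \<subseteq> C" if q: "prime q" for q
  proof
    fix g assume g: "g \<in> LC_p G q"
    then have gL: "g \<in> LC G" using LC_p_subset_LC by blast
    have "z \<otimes> g \<otimes> inv z \<otimes> inv g \<in> M"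
    proof (cases "q = p")
      case True
      then have "z \<otimes> g \<otimes> inv\<^bsub>?P\<^esub> z \<otimes> inv\<^bsub>?P\<^esub> g \<in> M"
        using z(1) g by (auto simp: central_mod_def)
      then show ?thesis using m_inv_consistent[OF P] zP g True by simp
    next
      case False
      then have "z \<otimes> g = g \<otimes> z" using LC_p_commute[OF p q _ zP g] by simp
      then have "z \<otimes> g \<otimes> inv z \<otimes> inv g = \<one>"
        using commutator_eq_one_iff zL gL Lc by blast
      then show ?thesis using M.one_closed by simp
    qed
    then show "g \<in> C" using gL zL by (simp add: C_def invL)
  qed
  then have "LC G \<subseteq> C" by (rule LC_subset_if_LC_p_subset[OF fin CG])
  then have "z \<in> central_mod ?L M" using zL by (auto simp: C_def central_mod_def)
  then show "\<not> central_mod ?L M \<subseteq> M" using zM by blast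
qed

text \<open>
  The first factor of the series is literally a quotient by the trivial subgroup, whose
  elements are singletons; the second claim covers it.
\<close>

lemma (in group) LC_nilpotent_group:
  assumes fin: "finite (carrier G)"
  shows "nilpotent_group (G\<lparr>carrier := LC G\<rparr>)"
    and "nilpotent_group (G\<lparr>carrier := LC G\<rparr> Mod {\<one>})"
proof -
  let ?L = "G\<lparr>carrier := LC G\<rparr>"
  have L: "subgroup (LC G) G" using LC_normal by (rule normal_imp_subgroup)
  interpret L: group ?L using L by (rule subgroup_imp_group)
  have finL: "finite (carrier ?L)" using fin subgroup.subset[OF L] by (simp add: finite_subset)
  show "nilpotent_group ?L"
    using finL LC_quotients_have_centre[OF fin] by (rule L.nilpotent_group_if_quotients_have_centre)
  interpret T: normal "{\<one>}" ?L using L.one_is_normal by simp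
  show "nilpotent_group (?L Mod {\<one>})"
  proof (rule group.nilpotent_group_if_quotients_have_centre)
    show "group (?L Mod {\<one>})" by (rule T.factorgroup_is_group)
    show "finite (carrier (?L Mod {\<one>}))" using finL by (simp add: carrier_FactGroup)
    show "quotients_have_centre (?L Mod {\<one>})"
      using LC_quotients_have_centre[OF fin] by (rule T.quotients_have_centre_quotient)
  qed
qed

section \<open>Normal cyclic subgroups supply LCM elements\<close>

text \<open>
  If conjugation by \<open>y\<close> raises \<open>w\<close> to the power \<open>k\<close>, moving all factors \<open>y\<close> of
  \<open>(w y)\<^sup>m\<close> to the right turns the successive \<open>w\<close> into its powers with exponents
  \<open>1, k, k\<^sup>2, \<dots>\<close>.
\<close>

lemma (in group) mult_pow_if_conj_is_pow:
  assumes w: "w \<in> carrier G" and y: "y \<in> carrier G" and k: "y \<otimes> w \<otimes> inv y = w [^] (k::int)"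
  shows "(w \<otimes> y) [^] m = w [^] (\<Sum>i<m. k ^ i) \<otimes> y [^] m"
    and "y [^] m \<otimes> w \<otimes> inv (y [^] m) = w [^] (k ^ m)"
proof -
  have push: "y \<otimes> w [^] j = w [^] (k * j) \<otimes> y" for j :: int
  proof -
    have "y \<otimes> w [^] j \<otimes> inv y = w [^] (k * j)"
      using int_pow_conj[OF y w, of j] k w by (simp add: int_pow_pow)
    then show ?thesis using w y by (metis int_pow_closed inv_solve_right m_closed)
  qed
  show "(w \<otimes> y) [^] m = w [^] (\<Sum>i<m. k ^ i) \<otimes> y [^] m"
  proof (induction m)
    case 0 then show ?case by simp
  next
    case (Suc m)
    let ?s = "\<Sum>i<m. k ^ i"
    have s: "(\<Sum>i<Suc m. k ^ i) = 1 + k * ?s"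
      by (simp only: sum.lessThan_Suc_shift power_Suc sum_distrib_left power_0)
    have "(w \<otimes> y) [^] Suc m = (w \<otimes> y) \<otimes> (w \<otimes> y) [^] m"
      using w y by (intro nat_pow_Suc2) simp
    also have "\<dots> = w \<otimes> (y \<otimes> w [^] ?s) \<otimes> y [^] m" using w y Suc by (simp add: m_assoc)
    also have "\<dots> = (w \<otimes> w [^] (k * ?s)) \<otimes> (y \<otimes> y [^] m)"
      using w y by (simp add: push m_assoc)
    also have "w \<otimes> w [^] (k * ?s) = w [^] (1 + k * ?s)"
      using w int_pow_mult[OF w, of 1 "k * ?s"] by (simp add: int_pow_1)
    also have "y \<otimes> y [^] m = y [^] Suc m" using y nat_pow_Suc2 by simp
    finally show ?case using s by simp
  qed
  show "y [^] m \<otimes> w \<otimes> inv (y [^] m) = w [^] (k ^ m)"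
  proof (induction m)
    case 0 then show ?case using w by (simp add: int_pow_1)
  next
    case (Suc m)
    have "y [^] Suc m \<otimes> w \<otimes> inv (y [^] Suc m) = y \<otimes> (y [^] m \<otimes> w \<otimes> inv (y [^] m)) \<otimes> inv y"
      using w y by (simp only: nat_pow_Suc2) (simp add: m_assoc inv_mult_group)
    also have "\<dots> = y \<otimes> w [^] (k ^ m) \<otimes> inv y" using Suc by simp
    also have "\<dots> = w [^] (k * k ^ m)" using w y by (simp add: push m_assoc)
    finally show ?case by simp
  qed
qed

text \<open>
  Let \<open>w\<close> be a nontrivial power of \<open>x\<close> and let conjugation by \<open>y\<close> raise it to the power
  \<open>k\<close>. For \<open>m = ord y\<close> conjugation by \<open>y\<^sup>m = 1\<close> fixes \<open>w\<close>, so the prime \<open>ord x\<close> divides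
  \<open>k\<^sup>m - 1 = (k - 1) (1 + k + \<dots> + k\<^bsup>m-1\<^esup>)\<close>, hence one of the two factors. If it divides the
  first, \<open>w\<close> and \<open>y\<close> commute; if the second, \<open>(w y)\<^sup>m = 1\<close>. When \<open>y\<close> has infinite order
  the lcm is 0 and everything divides it.
\<close>

lemma (in group) prime_order_normalized_in_LCM_set:
  assumes x: "x \<in> carrier G" and p: "prime (ord x)"
    and conj: "\<And>g. g \<in> carrier G \<Longrightarrow> \<exists>k::int. g \<otimes> x \<otimes> inv g = x [^] k"
  shows "x \<in> LCM_set G"
proof -
  have "ord (x [^] n \<otimes> y) dvd lcm (ord (x [^] n)) (ord y)" if y: "y \<in> carrier G" for y and n :: int
  proof (cases "x [^] n = \<one>")
    case True
    then show ?thesis using y by simp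
  next
    case False
    define w where "w = x [^] n"
    have w: "w \<in> carrier G" using x by (simp add: w_def)
    obtain k where k0: "y \<otimes> x \<otimes> inv y = x [^] (k::int)" using conj[OF y] by blast
    have k: "y \<otimes> w \<otimes> inv y = w [^] k"
      using int_pow_conj[OF y x, of n] x by (simp add: w_def k0 int_pow_pow mult.commute)
    have "w [^] ord x = (x [^] ord x) [^] n"
      using x unfolding w_def by (simp only: int_pow_pow mult.commute flip: int_pow_int)
    then have "ord w dvd ord x" using w x by (simp add: pow_eq_id)
    moreover have "ord w \<noteq> 1" using False w ord_eq_1 by (simp add: w_def)
    ultimately have ow: "ord w = ord x" using p by (metis prime_nat_iff)
    define m where "m = ord y"
    define s where "s = (\<Sum>i<m. k ^ i)"
    have "w [^] (k ^ m) = w [^] (1::int)"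
      using mult_pow_if_conj_is_pow(2)[OF w y k, of m] w y by (simp add: m_def int_pow_1)
    then have "int (ord w) dvd k ^ m - 1" using int_pow_eq[OF w] by (metis dvd_diff_commute)
    also have "k ^ m - 1 = (k - 1) * s" unfolding s_def by (rule power_diff_1_eq)
    finally consider "int (ord w) dvd s" | "int (ord w) dvd k - 1"
      using p unfolding ow by (metis prime_dvd_mult_iff prime_nat_int_transfer)
    then have "ord (w \<otimes> y) dvd lcm (ord w) (ord y)"
    proof cases
      case 1
      then have "w [^] s = \<one>" using int_pow_eq_id[OF w] by simp
      then have "(w \<otimes> y) [^] m = \<one>"
        using mult_pow_if_conj_is_pow(1)[OF w y k, of m] y by (simp add: s_def m_def)
      then have "ord (w \<otimes> y) dvd ord y" using w y by (simp add: pow_eq_id m_def)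
      then show ?thesis by (meson dvd_lcm2 dvd_trans)
    next
      case 2
      then have "w [^] k = w"
        using int_pow_eq[OF w, of 1 k] w by (simp add: int_pow_1)
      then have comm: "w \<otimes> y = y \<otimes> w" using k w y by (metis inv_solve_right' m_closed)
      let ?l = "lcm (ord w) (ord y)"
      have "(w \<otimes> y) [^] ?l = w [^] ?l \<otimes> y [^] ?l" by (rule pow_mult_distrib[OF comm w y])
      also have "w [^] ?l = \<one>" using w by (simp add: pow_eq_id)
      also have "y [^] ?l = \<one>" using y by (simp add: pow_eq_id)
      finally have "(w \<otimes> y) [^] ?l = \<one>" by simp
      then show ?thesis using w y by (simp add: pow_eq_id)
    qed
    then show ?thesis by (simp add: w_def)
  qed
  then show ?thesis using x by (simp add: LCM_set_def)
qed

text \<open>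
  The hypothesis says that \<open>c\<close> generates a normal subgroup. The power of \<open>c\<close> of prime order
  inherits it.
\<close>

lemma (in group) normal_cyclic_meets_LCM_set:
  assumes fin: "finite (carrier G)" and c: "c \<in> carrier G" "c \<noteq> \<one>"
    and conj: "\<And>g. g \<in> carrier G \<Longrightarrow> \<exists>k::int. g \<otimes> c \<otimes> inv g = c [^] k"
  obtains n :: nat where "c [^] n \<in> LCM_set G" "c [^] n \<noteq> \<one>"
proof -
  have "ord c \<noteq> 1" using c ord_eq_1 by simp
  then obtain p where p: "prime p" "p dvd ord c" using prime_factor_nat by blast
  then obtain n where n: "ord c = p * n" by auto
  have n0: "n > 0" using n ord_pos[OF fin c(1)] by (cases n) auto
  have o: "ord (c [^] n) = p" using ord_pow[OF c(1), of n] n n0 by simp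
  have "c [^] n \<in> LCM_set G"
  proof (rule prime_order_normalized_in_LCM_set)
    show "c [^] n \<in> carrier G" using c by simp
    show "prime (ord (c [^] n))" using o p by simp
    fix g assume g: "g \<in> carrier G"
    then obtain k where k: "g \<otimes> c \<otimes> inv g = c [^] (k::int)" using conj by blast
    have "g \<otimes> c [^] n \<otimes> inv g = (c [^] k) [^] int n"
      using int_pow_conj[OF g c(1), of "int n"] k by (simp add: int_pow_int)
    also have "\<dots> = (c [^] n) [^] k"
      using c by (simp only: int_pow_pow mult.commute flip: int_pow_int)
    finally show "\<exists>k::int. g \<otimes> c [^] n \<otimes> inv g = (c [^] n) [^] k" by blast
  qed
  moreover have "c [^] n \<noteq> \<one>" using o p(1) by auto
  ultimately show thesis using that by blast
qed

text \<open>
  Every nontrivial quotient of a supersolvable group has a nontrivial cyclic normal subgroup: take the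
  first term \<open>H i\<close> of the series that is not inside \<open>N\<close>. Its predecessor is inside \<open>N\<close>, so the
  image of \<open>H i\<close> in \<open>G Mod N\<close> is a quotient of a cyclic factor. Working with all normal \<open>N\<close> inside
  the one group \<open>G\<close> avoids transporting the series to quotient groups.
\<close>

lemma (in group) supersolvable_normal_cyclic_mod:
  assumes ss: "supersolvable_group G" and N: "N \<lhd> G" "N \<noteq> carrier G"
  obtains c where "c \<in> carrier G" "c \<notin> N"
    "\<And>g. g \<in> carrier G \<Longrightarrow> \<exists>k::int. N #> (g \<otimes> c \<otimes> inv g) = N #> (c [^] k)"
proof -
  interpret N: normal N G by (rule N)
  obtain n H where H: "normal_series G n H"
    and cyc: "\<And>i. i < n \<Longrightarrow> cyclic_group (G\<lparr>carrier := H (Suc i)\<rparr> Mod H i)"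
    using ss unfolding supersolvable_group_def by blast
  have H0: "H 0 = {\<one>}" and Hn: "H n = carrier G" and HN: "\<And>i. i \<le> n \<Longrightarrow> H i \<lhd> G"
    and HS: "\<And>i. i < n \<Longrightarrow> H i \<subseteq> H (Suc i)"
    using H by (auto simp: normal_series_def)
  define i where "i = (LEAST i. \<not> H i \<subseteq> N)"
  have ex: "\<not> H n \<subseteq> N" using Hn N(2) N.subset by auto
  have i: "\<not> H i \<subseteq> N" unfolding i_def using ex by (rule LeastI)
  have "i \<le> n" unfolding i_def using ex by (rule Least_le)
  have "i \<noteq> 0" using i H0 by auto
  then obtain j where j: "i = Suc j" using not0_implies_Suc by blast
  have jn: "j < n" using \<open>i \<le> n\<close> j by simp
  have HjN: "H j \<subseteq> N" using not_less_Least[of j "\<lambda>i. \<not> H i \<subseteq> N"] j by (auto simp: i_def)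
  interpret I: normal "H i" G using HN \<open>i \<le> n\<close> .
  interpret J: normal "H j" G using HN jn by simp
  let ?I = "G\<lparr>carrier := H i\<rparr>"
  interpret GI: group ?I using I.subgroup_axioms by (rule subgroup_imp_group)
  have "H j \<lhd> ?I"
    using normal_Int_subgroup[OF I.subgroup_axioms HN[of j]] HS[OF jn] jn j
    by (simp add: Int_absorb2)
  then interpret JI: normal "H j" ?I .
  interpret h: group_hom ?I "?I Mod H j" "\<lambda>x. H j #>\<^bsub>?I\<^esub> x" by (rule JI.quotient_hom)
  have "cyclic_group (?I Mod H j)" using cyc[OF jn] j by simp
  then obtain C where C: "C \<in> carrier (?I Mod H j)"
    "carrier (?I Mod H j) = range (\<lambda>n::int. C [^]\<^bsub>?I Mod H j\<^esub> n)"
    using h.H.cyclic_group by blast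
  obtain c where c: "c \<in> H i" "C = H j #>\<^bsub>?I\<^esub> c"
    using C(1) unfolding carrier_FactGroup by auto
  have cc: "c \<in> carrier G" using c(1) by auto
  have pow: "\<exists>k::int. N #> x = N #> (c [^] k)" if x: "x \<in> H i" for x
  proof -
    have "H j #>\<^bsub>?I\<^esub> x \<in> carrier (?I Mod H j)" using x by (auto simp: carrier_FactGroup)
    then obtain k :: int where "H j #>\<^bsub>?I\<^esub> x = C [^]\<^bsub>?I Mod H j\<^esub> k" using C(2) by auto
    also have "\<dots> = H j #>\<^bsub>?I\<^esub> (c [^]\<^bsub>?I\<^esub> k)" using c h.hom_int_pow by simp
    also have "c [^]\<^bsub>?I\<^esub> k = c [^] k"
      using int_pow_consistent[OF I.subgroup_axioms c(1)] by simp
    finally have "H j #> x = H j #> (c [^] k)" by (simp add: r_coset_def)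
    then have "x \<in> H j #> (c [^] k)" using x rcos_self[OF _ J.subgroup_axioms, of x] by auto
    then have "x \<in> N #> (c [^] k)" using HjN by (auto simp: r_coset_def)
    then have "N #> x = N #> (c [^] k)"
      using repr_independence[OF _ _ N.subgroup_axioms] cc by simp
    then show ?thesis by blast
  qed
  show thesis
  proof (rule that[OF cc])
    show "c \<notin> N"
    proof
      assume "c \<in> N"
      then have "N #> (c [^] k) = N" for k :: int
        using N.rcos_const subgroup_int_pow_closed[OF N.subgroup_axioms] is_group by simp
      then have "x \<in> N" if "x \<in> H i" for x
        using pow[OF that] N.rcos_eq_one_iff that by auto
      then show False using i by blast
    qed
    fix g assume "g \<in> carrier G"
    then have "g \<otimes> c \<otimes> inv g \<in> H i" using c(1) by (rule I.inv_op_closed2)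
    then show "\<exists>k::int. N #> (g \<otimes> c \<otimes> inv g) = N #> (c [^] k)" by (rule pow)
  qed
qed

section \<open>The ascending series of a supersolvable group\<close>

lemma (in group) supersolvable_LC_nontrivial:
  assumes fin: "finite (carrier G)" and ss: "supersolvable_group G" and nt: "carrier G \<noteq> {\<one>}"
  shows "LC G \<noteq> {\<one>}"
proof -
  obtain c where c: "c \<in> carrier G" "c \<notin> {\<one>}" and
    conj: "\<And>g. g \<in> carrier G \<Longrightarrow> \<exists>k::int. {\<one>} #> (g \<otimes> c \<otimes> inv g) = {\<one>} #> (c [^] k)"
    using supersolvable_normal_cyclic_mod[OF ss one_is_normal] nt by metis
  have "\<exists>k::int. g \<otimes> c \<otimes> inv g = c [^] k" if "g \<in> carrier G" for g
    using conj[OF that] c that by (simp add: r_coset_def)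
  then obtain n :: nat where n: "c [^] n \<in> LCM_set G" "c [^] n \<noteq> \<one>"
    using normal_cyclic_meets_LCM_set[OF fin c(1)] c(2) by blast
  then have "c [^] n \<in> LC G" unfolding LC_def by (intro generate.incl)
  then show ?thesis using n(2) by blast
qed

lemma (in normal) supersolvable_LC_quotient_nontrivial:
  assumes fin: "finite (carrier G)" and ss: "supersolvable_group G" and nt: "H \<noteq> carrier G"
  shows "\<exists>x\<in>carrier G. x \<notin> H \<and> H #> x \<in> LC (G Mod H)"
proof -
  interpret h: group_hom G "G Mod H" "\<lambda>x. H #> x" by (rule quotient_hom)
  have one: "\<one>\<^bsub>G Mod H\<^esub> = H" by simp
  obtain c where c: "c \<in> carrier G" "c \<notin> H" and
    conj: "\<And>g. g \<in> carrier G \<Longrightarrow> \<exists>k::int. H #> (g \<otimes> c \<otimes> inv g) = H #> (c [^] k)"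
    using supersolvable_normal_cyclic_mod[OF ss normal_axioms nt] by metis
  have "\<exists>k::int. y \<otimes>\<^bsub>G Mod H\<^esub> (H #> c) \<otimes>\<^bsub>G Mod H\<^esub> inv\<^bsub>G Mod H\<^esub> y = (H #> c) [^]\<^bsub>G Mod H\<^esub> k"
    if y: "y \<in> carrier (G Mod H)" for y
  proof -
    obtain g where g: "g \<in> carrier G" "y = H #> g" using y by (auto simp: carrier_FactGroup)
    then show ?thesis using conj[OF g(1)] c h.hom_int_pow[OF c(1)]
      by (simp del: mult_FactGroup)
  qed
  moreover have "finite (carrier (G Mod H))" using fin by (simp add: carrier_FactGroup)
  moreover have "H #> c \<noteq> \<one>\<^bsub>G Mod H\<^esub>" using c rcos_eq_one_iff by simp
  moreover have "H #> c \<in> carrier (G Mod H)" using c by simp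
  ultimately obtain n :: nat where n: "(H #> c) [^]\<^bsub>G Mod H\<^esub> n \<in> LCM_set (G Mod H)"
      "(H #> c) [^]\<^bsub>G Mod H\<^esub> n \<noteq> \<one>\<^bsub>G Mod H\<^esub>"
    using h.H.normal_cyclic_meets_LCM_set by metis
  have e: "(H #> c) [^]\<^bsub>G Mod H\<^esub> n = H #> (c [^] n)" using h.hom_nat_pow[OF c(1)] by simp
  have "H #> (c [^] n) \<in> LC (G Mod H)" using n(1) unfolding e LC_def by (intro generate.incl)
  moreover have "c [^] n \<notin> H" using n(2) c rcos_eq_one_iff unfolding e by simp
  ultimately show ?thesis using c by blast
qed

lemma (in group) LC_series_strict:
  assumes fin: "finite (carrier G)" and ss: "supersolvable_group G"
    and ne: "LC_series G i \<noteq> carrier G"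
  shows "LC_series G i \<subset> LC_series G (Suc i)"
proof (cases i)
  case 0
  have "\<one> \<in> LC G" using LC_normal normal_imp_subgroup subgroup.one_closed by blast
  then show ?thesis using supersolvable_LC_nontrivial[OF fin ss] ne 0 by auto
next
  case (Suc j)
  interpret N: normal "LC_series G (Suc j)" G by (rule LC_series_normal)
  have "LC_series G (Suc j) \<subseteq> LC_series G (Suc (Suc j))"
    using LC_series_quotient(1)[of "Suc (Suc j)"] by simp
  moreover obtain x where "x \<in> carrier G" "x \<notin> LC_series G (Suc j)"
    "LC_series G (Suc j) #> x \<in> LC (G Mod LC_series G (Suc j))"
    using N.supersolvable_LC_quotient_nontrivial[OF fin ss] ne Suc by blast
  then have "x \<in> LC_series G (Suc (Suc j)) - LC_series G (Suc j)" by simp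
  ultimately show ?thesis unfolding Suc by blast
qed

text \<open>
  For \<open>i \<ge> 2\<close> the factor is equal, as a record, to the subgroup \<open>LC\<close> of the quotient group, so
  no isomorphism has to be transported.
\<close>

lemma (in group) LC_series_factor_nilpotent:
  assumes fin: "finite (carrier G)" and i: "i \<ge> 1"
  shows "nilpotent_group (G\<lparr>carrier := LC_series G i\<rparr> Mod LC_series G (i - 1))"
proof (cases "i = 1")
  case True
  then show ?thesis using LC_nilpotent_group(2)[OF fin] by simp
next
  case False
  define N where "N = LC_series G (i - 1)"
  interpret N: normal N G unfolding N_def by (rule LC_series_normal)
  interpret Q: group "G Mod N" by (rule N.factorgroup_is_group)
  have "carrier (G\<lparr>carrier := LC_series G i\<rparr> Mod N) = LC (G Mod N)"
    unfolding N_def using LC_series_quotient(2)[of i] False i by simp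
  then have "G\<lparr>carrier := LC_series G i\<rparr> Mod N = (G Mod N)\<lparr>carrier := LC (G Mod N)\<rparr>"
    by (intro monoid.equality) (auto simp: set_mult_def fun_eq_iff)
  moreover have "finite (carrier (G Mod N))" using fin by (simp add: carrier_FactGroup)
  ultimately show ?thesis using Q.LC_nilpotent_group(1) by (simp add: N_def)
qed

theorem corollary3p11:
  fixes G :: "('a, 'b) monoid_scheme"
  assumes "group G" and "finite (carrier G)" and "supersolvable_group G"
  shows "LC_nilpotent G"
proof -
  interpret group G by (rule assms(1))
  have "\<exists>k. LC_series G k = carrier G"
  proof (rule increasing_chain_reaches_top[OF assms(2)])
    show "LC_series G i \<subseteq> carrier G" for i
      using LC_series_normal normal_imp_subgroup subgroup.subset by blast
    show "LC_series G i \<subset> LC_series G (Suc i)" if "LC_series G i \<noteq> carrier G" for i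
      using LC_series_strict[OF assms(2,3) that] .
  qed
  then show ?thesis
    using LC_series_factor_nilpotent[OF assms(2)] by (auto simp: LC_nilpotent_def)
qed

end
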